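(* Let $I$ be an infinite index set, let $E$ be a subspace of $\mathbb{R}^I$ with absolute, normalised norm such that $\operatorname{span}\{e_i:i\in I\}$ is dense in $E$, and let $(X_i)_{i\in I}$ be a family of Banach spaces with $$\alpha:=\sup\Bigl\{R\Bigl(\Bigl[\bigoplus_{i\in J}X_i\Bigr]_E\Bigr): J\subseteq I \text{ finite}\Bigr\}<2$$ and $\delta_E\bigl((1-\alpha/2)^2\bigr)>0$. Then $R\bigl(\bigl[\bigoplus_{i\in I}X_i\bigr]_E\bigr)<2$.
   Context: All Banach spaces are real; $B_X$ denotes the closed unit ball of $X$. A subspace $E\subseteq\mathbb{R}^I$ with absolute, normalised norm is a linear subspace of the space of all real-valued functions on $I$ which contains all functions with finite support and is endowed with a complete norm $\|\cdot\|_E$ such that: (i) if $(a_i)_{i\in I}\in E$ and $(b_i)_{i\in I}\in\mathbb{R}^I$ satisfy $|a_i|=|b_i|$ for all $i\in I$, then $(b_i)_{i\in I}\in E$ and $\|(b_i)_{i\in I}\|_E=\|(a_i)_{i\in I}\|_E$; (ii) $\|e_i\|_E=1$ for all $i\in I$, where $e_i\in\mathbb{R}^I$ is the function with value $1$ at $i$ and $0$ elsewhere. For a family $(X_i)_{i\in I}$ of Banach spaces, the absolute sum with respect to $E$ is $\bigl[\bigoplus_{i\in I}X_i\bigr]_E:=\{(x_i)_{i\in I}\in\prod_{i\in I}X_i : (\|x_i\|)_{i\in I}\in E\}$ with norm $\|(x_i)_{i\in I}\|_E:=\|(\|x_i\|)_{i\in I}\|_E$; it is a Banach space. For $J\subseteq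 I$, $\bigl[\bigoplus_{i\in J}X_i\bigr]_E$ denotes the absolute sum of the family whose $i$-th member is $X_i$ for $i\in J$ and $\{0\}$ for $i\in I\setminus J$. The García-Falset coefficient of a Banach space $X$ is $R(X):=\sup\{\liminf_{n\to\infty}\|x_n+x\|\}$, the supremum being over all $x\in B_X$ and all weakly null sequences $(x_n)_{n\in\mathbb{N}}$ in $B_X$. The modulus of convexity of $E$ is, for $0<\varepsilon\leq 2$, $\delta_E(\varepsilon):=\inf\{1-\|\tfrac{x+y}{2}\|_E : x,y\in B_E,\ \|x-y\|_E\geq\varepsilon\}$. *)

theory Defs
  imports "HOL-Analysis.Analysis" "HOL-Library.Function_Algebras"
begin

(* The pointwise real vector space structure on functions. *)

instantiation "fun" :: (type, real_vector) real_vector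
begin

definition scaleR_fun :: "real \<Rightarrow> ('a \<Rightarrow> 'b) \<Rightarrow> 'a \<Rightarrow> 'b" where
  "scaleR_fun c f = (\<lambda>x. c *\<^sub>R f x)"

instance
  by standard (simp_all add: scaleR_fun_def fun_eq_iff scaleR_add_right scaleR_add_left)

end

(* A normed space is given by a linear subspace V of an ambient real vector space together with
   its own norm N, of which only the values on V matter; the ambient space carries no norm or
   topology.  This allows families of pairwise different spaces: every family of Banach spaces
   embeds algebraically in the direct sum of the underlying vector spaces, each member keeping
   its norm. *)

definition normed_on :: "'a::real_vector set \<Rightarrow> ('a \<Rightarrow> real) \<Rightarrow> bool" where
  "normed_on V N \<longleftrightarrow> subspace V
     \<and> (\<forall>x\<in>V. 0 \<le> N x) \<and> (\<forall>x\<in>V. N x = 0 \<longleftrightarrow> x = 0)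
     \<and> (\<forall>c. \<forall>x\<in>V. N (c *\<^sub>R x) = \<bar>c\<bar> * N x)
     \<and> (\<forall>x\<in>V. \<forall>y\<in>V. N (x + y) \<le> N x + N y)"

definition complete_on :: "'a::real_vector set \<Rightarrow> ('a \<Rightarrow> real) \<Rightarrow> bool" where
  "complete_on V N \<longleftrightarrow> (\<forall>x::nat \<Rightarrow> 'a. (\<forall>n. x n \<in> V)
     \<and> (\<forall>\<epsilon>>0. \<exists>M. \<forall>m\<ge>M. \<forall>n\<ge>M. N (x m - x n) < \<epsilon>)
     \<longrightarrow> (\<exists>l\<in>V. (\<lambda>n. N (x n - l)) \<longlonglongrightarrow> 0))"

definition banach_on :: "'a::real_vector set \<Rightarrow> ('a \<Rightarrow> real) \<Rightarrow> bool" where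
  "banach_on V N \<longleftrightarrow> normed_on V N \<and> complete_on V N"

definition unit_ball :: "'a set \<Rightarrow> ('a \<Rightarrow> real) \<Rightarrow> 'a set" where
  "unit_ball V N = {x\<in>V. N x \<le> 1}"

(* Functionals are total functions on the ambient type; only their restriction to V matters. *)

definition bounded_functional_on :: "'a::real_vector set \<Rightarrow> ('a \<Rightarrow> real) \<Rightarrow> ('a \<Rightarrow> real) \<Rightarrow> bool" where
  "bounded_functional_on V N \<phi> \<longleftrightarrow>
     (\<forall>x\<in>V. \<forall>y\<in>V. \<phi> (x + y) = \<phi> x + \<phi> y)
     \<and> (\<forall>c. \<forall>x\<in>V. \<phi> (c *\<^sub>R x) = c * \<phi> x)
     \<and> (\<exists>C. \<forall>x\<in>V. \<bar>\<phi> x\<bar> \<le> C * N x)"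

definition weakly_null_on :: "'a::real_vector set \<Rightarrow> ('a \<Rightarrow> real) \<Rightarrow> (nat \<Rightarrow> 'a) \<Rightarrow> bool" where
  "weakly_null_on V N x \<longleftrightarrow> (\<forall>n. x n \<in> V)
     \<and> (\<forall>\<phi>. bounded_functional_on V N \<phi> \<longrightarrow> (\<lambda>n. \<phi> (x n)) \<longlonglongrightarrow> 0)"

(* Extended-real valued, since liminf lives in complete lattices; on a normed space the value
   is a real number in [0, 2]. *)

definition garcia_falset :: "'a::real_vector set \<Rightarrow> ('a \<Rightarrow> real) \<Rightarrow> ereal" where
  "garcia_falset V N = Sup {liminf (\<lambda>n. ereal (N (x n + y))) | x y.
     y \<in> unit_ball V N \<and> (\<forall>n. x n \<in> unit_ball V N) \<and> weakly_null_on V N x}"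

(* Meaningful for 0 < \<epsilon> \<le> 2 and V \<noteq> {0}, where the set is nonempty and bounded below. *)

definition convexity_modulus :: "'a::real_vector set \<Rightarrow> ('a \<Rightarrow> real) \<Rightarrow> real \<Rightarrow> real" where
  "convexity_modulus V N \<epsilon> = Inf {1 - N ((1/2) *\<^sub>R (x + y)) | x y.
     x \<in> unit_ball V N \<and> y \<in> unit_ball V N \<and> N (x - y) \<ge> \<epsilon>}"

definition unit_fun :: "'i \<Rightarrow> 'i \<Rightarrow> real" where
  "unit_fun i = (\<lambda>j. if j = i then 1 else 0)"

definition absolute_normalised :: "('i \<Rightarrow> real) set \<Rightarrow> (('i \<Rightarrow> real) \<Rightarrow> real) \<Rightarrow> bool" where
  "absolute_normalised E nE \<longleftrightarrow> banach_on E nE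
     \<and> (\<forall>a. finite {i. a i \<noteq> 0} \<longrightarrow> a \<in> E)
     \<and> (\<forall>a b. a \<in> E \<and> (\<forall>i. \<bar>a i\<bar> = \<bar>b i\<bar>) \<longrightarrow> b \<in> E \<and> nE b = nE a)
     \<and> (\<forall>i. nE (unit_fun i) = 1)"

definition dense_in :: "'a::real_vector set \<Rightarrow> 'a set \<Rightarrow> ('a \<Rightarrow> real) \<Rightarrow> bool" where
  "dense_in D V N \<longleftrightarrow> D \<subseteq> V \<and> (\<forall>x\<in>V. \<forall>\<epsilon>>0. \<exists>y\<in>D. N (x - y) < \<epsilon>)"

definition abs_sum :: "('i \<Rightarrow> real) set \<Rightarrow> ('i \<Rightarrow> 'b set) \<Rightarrow> ('i \<Rightarrow> 'b \<Rightarrow> real) \<Rightarrow> ('i \<Rightarrow> 'b) set" where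
  "abs_sum E X nX = {x. (\<forall>i. x i \<in> X i) \<and> (\<lambda>i. nX i (x i)) \<in> E}"

definition abs_sum_norm :: "(('i \<Rightarrow> real) \<Rightarrow> real) \<Rightarrow> ('i \<Rightarrow> 'b \<Rightarrow> real) \<Rightarrow> ('i \<Rightarrow> 'b) \<Rightarrow> real" where
  "abs_sum_norm nE nX x = nE (\<lambda>i. nX i (x i))"

definition restrict_family :: "'i set \<Rightarrow> ('i \<Rightarrow> 'b::zero set) \<Rightarrow> 'i \<Rightarrow> 'b set" where
  "restrict_family J X = (\<lambda>i. if i \<in> J then X i else {0})"

end

theory Submission
  imports Defs
begin

text \<open>
  Write \<open>Z\<close> for the full absolute sum and \<open>Z\<^sub>J\<close> for the sum over a finite \<open>J\<close>. The theorem follows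
  from the estimate \<open>R(Z) \<le> max (2 - 2\<delta>\<^sub>E(\<epsilon>)) (\<alpha> + \<epsilon>)\<close>, which holds for every real \<open>\<epsilon>\<close>
  (lemma \<open>garcia_falset_abs_sum_le\<close>): with \<open>\<epsilon> = (1 - \<alpha>/2)\<^sup>2\<close> the first term is below \<open>2\<close> by
  hypothesis, and the second one is \<open>1 + (\<alpha>/2)\<^sup>2 < 2\<close>.

  For the estimate, let \<open>x\<close> be in the unit ball of \<open>Z\<close> and let \<open>(x\<^sub>n)\<close> be weakly null in that ball.
  By density of the finitely supported functions, all but a part of \<open>x\<close> of small norm lives on some
  finite \<open>J\<close>. The restrictions of the \<open>x\<^sub>n\<close> to \<open>J\<close> are weakly null in \<open>Z\<^sub>J\<close>, so that
  \<open>\<parallel>(x\<^sub>n + x)|\<^sub>J\<parallel>\<close> is at most about \<open>\<alpha>\<close> for infinitely many \<open>n\<close>. For such an \<open>n\<close> compare the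
  scalar functions \<open>a = (\<parallel>x\<^sub>n(i)\<parallel>)\<^sub>i\<close> and \<open>b = (\<parallel>x(i)\<parallel>)\<^sub>i\<close> in the unit ball of \<open>E\<close>. If
  \<open>\<parallel>a - b\<parallel> \<ge> \<epsilon>\<close>, then convexity of \<open>E\<close> gives \<open>\<parallel>x\<^sub>n + x\<parallel> \<le> \<parallel>a + b\<parallel> \<le> 2 - 2\<delta>\<^sub>E(\<epsilon>)\<close>. If
  \<open>\<parallel>a - b\<parallel> < \<epsilon>\<close>, then off \<open>J\<close>, where \<open>b\<close> nearly vanishes, \<open>a\<close> has norm at most about \<open>\<epsilon>\<close>;
  hence \<open>\<parallel>x\<^sub>n + x\<parallel>\<close> is at most about \<open>\<alpha> + \<epsilon>\<close>.

  The comparison of norms in \<open>Z\<close> with norms in \<open>E\<close> rests on the fact that \<open>E\<close> is a lattice ideal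
  with a monotone norm (lemma \<open>mono_E\<close>), which has to be derived from the invariance of \<open>E\<close> under
  changes of sign.
\<close>

section \<open>Absolute norms are monotone\<close>

definition restrict_coords :: "'i set \<Rightarrow> ('i \<Rightarrow> 'b::zero) \<Rightarrow> 'i \<Rightarrow> 'b" where
  "restrict_coords S x = (\<lambda>i. if i \<in> S then x i else 0)"

lemma finite_support_span_unit_fun:
  assumes "y \<in> span (range unit_fun)"
  shows "finite {i. y i \<noteq> 0}"
  using assms
proof (induction rule: span_induct_alt)
  case base
  then show ?case by simp
next
  case (step c x y)
  then obtain j where "x = unit_fun j" by auto
  then have "{i. (c *\<^sub>R x + y) i \<noteq> 0} \<subseteq> insert j {i. y i \<noteq> 0}"
    by (auto simp: unit_fun_def scaleR_fun_def)
  with step show ?case by (meson finite_insert finite_subset)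
qed

locale absolute_space =
  fixes E :: "('i \<Rightarrow> real) set" and nE :: "('i \<Rightarrow> real) \<Rightarrow> real"
  assumes absolute: "absolute_normalised E nE"
begin

lemma subspace_E: "subspace E"
  and nonneg_E: "a \<in> E \<Longrightarrow> 0 \<le> nE a"
  and eq_0_E: "a \<in> E \<Longrightarrow> nE a = 0 \<longleftrightarrow> a = 0"
  and scale_E: "a \<in> E \<Longrightarrow> nE (c *\<^sub>R a) = \<bar>c\<bar> * nE a"
  and triangle_E: "a \<in> E \<Longrightarrow> b \<in> E \<Longrightarrow> nE (a + b) \<le> nE a + nE b"
  using absolute by (auto simp: absolute_normalised_def banach_on_def normed_on_def)

lemma complete_E: "complete_on E nE"
  and abs_cong_E: "a \<in> E \<Longrightarrow> (\<And>i. \<bar>a i\<bar> = \<bar>b i\<bar>) \<Longrightarrow> b \<in> E \<and> nE b = nE a"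
  and norm_unit_fun: "nE (unit_fun i) = 1"
  and finite_support_E: "finite {i. a i \<noteq> 0} \<Longrightarrow> a \<in> E"
  using absolute by (auto simp: absolute_normalised_def banach_on_def)

lemmas add_E = subspace_add[OF subspace_E]
  and diff_E = subspace_diff[OF subspace_E]
  and scaleR_E = subspace_scale[OF subspace_E]
  and zero_E = subspace_0[OF subspace_E]

lemma unit_fun_E: "unit_fun i \<in> E"
  by (rule finite_support_E) (simp add: unit_fun_def)

text \<open>A restriction is the average of \<open>a\<close> and of \<open>a\<close> with its sign changed off \<open>S\<close>.\<close>

lemma restrict_E:
  assumes "a \<in> E"
  shows "restrict_coords S a \<in> E" "nE (restrict_coords S a) \<le> nE a"
proof -
  define b where "b = (\<lambda>i. if i \<in> S then a i else - a i)"
  have b: "b \<in> E" "nE b = nE a"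
    using abs_cong_E[OF assms, of b] by (auto simp: b_def)
  have eq: "restrict_coords S a = (1/2) *\<^sub>R (a + b)"
    by (auto simp: restrict_coords_def b_def scaleR_fun_def fun_eq_iff)
  show "restrict_coords S a \<in> E"
    unfolding eq using assms b by (intro scaleR_E add_E)
  show "nE (restrict_coords S a) \<le> nE a"
    unfolding eq using triangle_E[OF assms b(1)] b scale_E[OF add_E[OF assms b(1)], of "1/2"]
    by simp
qed

lemma coord_le_norm_E:
  assumes "a \<in> E"
  shows "\<bar>a i\<bar> \<le> nE a"
proof -
  have "restrict_coords {i} a = a i *\<^sub>R unit_fun i"
    by (auto simp: restrict_coords_def unit_fun_def scaleR_fun_def fun_eq_iff)
  then have "nE (restrict_coords {i} a) = \<bar>a i\<bar>"
    using scale_E[OF unit_fun_E] by (simp add: norm_unit_fun)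
  with restrict_E(2)[OF assms, of "{i}"] show ?thesis by simp
qed

end

text \<open>
  The greedy binary expansion of \<open>t \<in> [0, 1]\<close>, cut off after \<open>n\<close> digits.
\<close>

primrec dyadic :: "nat \<Rightarrow> real \<Rightarrow> real" where
  "dyadic 0 t = 0"
| "dyadic (Suc n) t = dyadic n t + (if dyadic n t + (1/2) ^ Suc n \<le> t then (1/2) ^ Suc n else 0)"

lemma dyadic_bounds:
  assumes "0 \<le> t" "t \<le> 1"
  shows "dyadic n t \<le> t \<and> t \<le> dyadic n t + (1/2) ^ n"
  using assms by (induction n) auto

context absolute_space
begin

text \<open>
  Multiplication of \<open>b\<close> by a function \<open>t\<close> with values in \<open>[0, 1]\<close> is a superposition of restrictions
  of \<open>b\<close>: the \<open>k\<close>-th binary digit of \<open>t\<close> is the indicator function of a set \<open>S\<^sub>k\<close>, and the series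
  \<open>\<Sum>k. 2\<^sup>-\<^sup>k b|\<^sub>S\<^sub>k\<close> converges absolutely in \<open>E\<close>. Its sum is \<open>t b\<close> because convergence in \<open>E\<close>
  implies coordinatewise convergence.
\<close>

lemma multiplier_E:
  assumes b: "b \<in> E" and t: "\<And>i. 0 \<le> t i" "\<And>i. t i \<le> 1"
  shows "(\<lambda>i. t i * b i) \<in> E \<and> nE (\<lambda>i. t i * b i) \<le> nE b"
proof -
  define w where "w n = (\<lambda>i. dyadic n (t i) * b i)" for n
  define S where "S n = {i. dyadic n (t i) + (1/2) ^ Suc n \<le> t i}" for n
  have w_Suc: "w (Suc n) = w n + (1/2) ^ Suc n *\<^sub>R restrict_coords (S n) b" for n
    by (auto simp: w_def S_def restrict_coords_def scaleR_fun_def fun_eq_iff algebra_simps)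
  have w_0: "w 0 = 0"
    by (simp add: w_def fun_eq_iff)
  have digit: "(1/2) ^ Suc n *\<^sub>R restrict_coords (S n) b \<in> E"
    "nE ((1/2) ^ Suc n *\<^sub>R restrict_coords (S n) b) \<le> (1/2) ^ Suc n * nE b" for n
  proof -
    show "(1/2) ^ Suc n *\<^sub>R restrict_coords (S n) b \<in> E"
      by (intro scaleR_E restrict_E b)
    have "nE ((1/2) ^ Suc n *\<^sub>R restrict_coords (S n) b)
        = (1/2) ^ Suc n * nE (restrict_coords (S n) b)"
      by (subst scale_E[OF restrict_E(1)[OF b]]) simp
    also have "\<dots> \<le> (1/2) ^ Suc n * nE b"
      by (intro mult_left_mono restrict_E b) simp
    finally show "nE ((1/2) ^ Suc n *\<^sub>R restrict_coords (S n) b) \<le> (1/2) ^ Suc n * nE b" .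
  qed
  have w_E: "w n \<in> E" for n
    by (induction n) (auto simp only: w_0 w_Suc intro: zero_E add_E digit)
  have tail: "nE (w (m + k) - w m) \<le> ((1/2) ^ m - (1/2) ^ (m + k)) * nE b" for m k
  proof (induction k)
    case 0
    have "nE 0 = 0" using eq_0_E[OF zero_E] by simp
    then show ?case by (simp only: add_0_right diff_self mult_zero_left order_refl)
  next
    case (Suc k)
    have "w (m + Suc k) - w m
        = (w (m + k) - w m) + (1/2) ^ Suc (m + k) *\<^sub>R restrict_coords (S (m + k)) b"
      by (simp only: add_Suc_right w_Suc) (simp add: algebra_simps)
    then have "nE (w (m + Suc k) - w m) \<le> nE (w (m + k) - w m)
        + nE ((1/2) ^ Suc (m + k) *\<^sub>R restrict_coords (S (m + k)) b)"
      using triangle_E[OF diff_E[OF w_E w_E] digit(1)] by metis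
    also have "\<dots> \<le> ((1/2) ^ m - (1/2) ^ (m + k)) * nE b + (1/2) ^ Suc (m + k) * nE b"
      by (intro add_mono Suc digit)
    also have "\<dots> = ((1/2) ^ m - (1/2) ^ (m + Suc k)) * nE b"
      by (simp add: algebra_simps)
    finally show ?case .
  qed
  have tail_le: "nE (w n - w m) \<le> (1/2) ^ m * nE b" if "m \<le> n" for m n
  proof -
    have "((1/2) ^ m - (1/2) ^ n) * nE b \<le> (1/2) ^ m * nE b"
      using nonneg_E[OF b] by (intro mult_right_mono) auto
    with tail[of m "n - m"] that show ?thesis by simp
  qed
  have sym: "nE (w m - w n) = nE (w n - w m)" for m n
    using scale_E[OF diff_E[OF w_E[of n] w_E[of m]], of "-1"] by simp
  have small: "(\<lambda>n. (1/2) ^ n * c) \<longlonglongrightarrow> 0" for c :: real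
    by (intro tendsto_mult_left_zero LIMSEQ_power_zero) simp
  have "\<exists>M. \<forall>m\<ge>M. \<forall>n\<ge>M. nE (w m - w n) < e" if "0 < e" for e
  proof -
    obtain M where M: "\<And>n. n \<ge> M \<Longrightarrow> (1/2) ^ n * nE b < e"
      using order_tendstoD(2)[OF small \<open>0 < e\<close>] unfolding eventually_sequentially by blast
    have "nE (w m - w n) < e" if "m \<ge> M" "n \<ge> M" for m n
      using M[OF that(1)] M[OF that(2)] tail_le[of m n] tail_le[of n m] sym[of m n]
      by (cases m n rule: linorder_le_cases) auto
    then show ?thesis by blast
  qed
  with complete_E w_E obtain l where l: "l \<in> E" and lim: "(\<lambda>n. nE (w n - l)) \<longlonglongrightarrow> 0"
    unfolding complete_on_def by blast
  have l_eq: "l = (\<lambda>i. t i * b i)"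
  proof
    fix i
    have "(\<lambda>n. w n i - l i) \<longlonglongrightarrow> 0"
    proof (rule Lim_null_comparison[OF _ lim], rule always_eventually, rule allI)
      show "norm (w n i - l i) \<le> nE (w n - l)" for n
        using coord_le_norm_E[OF diff_E[OF w_E[of n] l], of i] by simp
    qed
    then have "(\<lambda>n. w n i) \<longlonglongrightarrow> l i"
      by (simp add: LIM_zero_iff)
    moreover have "(\<lambda>n. w n i - t i * b i) \<longlonglongrightarrow> 0"
    proof (rule Lim_null_comparison[OF _ small], rule always_eventually, rule allI)
      fix n
      have "\<bar>dyadic n (t i) - t i\<bar> \<le> (1/2) ^ n"
        using dyadic_bounds[OF t, of n i] by auto
      then have "\<bar>dyadic n (t i) - t i\<bar> * \<bar>b i\<bar> \<le> (1/2) ^ n * \<bar>b i\<bar>"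
        by (rule mult_right_mono) simp
      then show "norm (w n i - t i * b i) \<le> (1/2) ^ n * \<bar>b i\<bar>"
        by (simp add: w_def abs_mult[symmetric] left_diff_distrib)
    qed
    then have "(\<lambda>n. w n i) \<longlonglongrightarrow> t i * b i"
      by (simp add: LIM_zero_iff)
    ultimately show "l i = t i * b i"
      by (rule LIMSEQ_unique)
  qed
  have "nE l \<le> nE b + nE (w n - l)" for n
  proof -
    have "nE (w n) \<le> nE b"
      using tail_le[of 0 n] by (simp add: w_0)
    moreover have "nE l \<le> nE (w n) + nE (l - w n)"
      using triangle_E[OF w_E diff_E[OF l w_E], of n n] by simp
    moreover have "nE (l - w n) = nE (w n - l)"
      using scale_E[OF diff_E[OF w_E[of n] l], of "-1"] by simp
    ultimately show ?thesis by simp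
  qed
  then have "nE l \<le> nE b"
    using LIMSEQ_le_const[OF tendsto_add[OF tendsto_const lim], of "nE l" "nE b"] by auto
  with l show ?thesis by (simp add: l_eq)
qed

lemma mono_E:
  assumes b: "b \<in> E" and le: "\<And>i. \<bar>a i\<bar> \<le> \<bar>b i\<bar>"
  shows "a \<in> E" "nE a \<le> nE b"
proof -
  \<comment> \<open>Where \<open>b\<close> vanishes so does \<open>a\<close>, and the convention \<open>x / 0 = 0\<close> gives the multiplier \<open>0\<close>.\<close>
  define t where "t i = \<bar>a i\<bar> / \<bar>b i\<bar>" for i
  have "0 \<le> t i" "t i \<le> 1" for i
    using le[of i] by (auto simp: t_def divide_le_eq_1)
  then have *: "(\<lambda>i. t i * b i) \<in> E \<and> nE (\<lambda>i. t i * b i) \<le> nE b"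
    by (rule multiplier_E[OF b])
  have "\<bar>t i * b i\<bar> = \<bar>a i\<bar>" for i
    using le[of i] by (auto simp: t_def abs_mult)
  with * abs_cong_E[of "\<lambda>i. t i * b i" a] show "a \<in> E" "nE a \<le> nE b"
    by auto
qed

text \<open>
  Cutting \<open>b\<close> off at the support of a nearby finitely supported \<open>y\<close> does no worse than \<open>y\<close> itself:
  the tails of \<open>b\<close> and of \<open>b - y\<close> off that support agree.
\<close>

lemma finite_set_small_tail:
  assumes dense: "dense_in (span (range unit_fun)) E nE" and b: "b \<in> E" and "0 < e"
  obtains J where "finite J" "nE (restrict_coords (- J) b) < e"
proof -
  obtain y where y: "y \<in> span (range unit_fun)" "nE (b - y) < e"
    using dense b \<open>0 < e\<close> unfolding dense_in_def by blast
  have fin: "finite {i. y i \<noteq> 0}"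
    using y(1) by (rule finite_support_span_unit_fun)
  have "restrict_coords (- {i. y i \<noteq> 0}) b = restrict_coords (- {i. y i \<noteq> 0}) (b - y)"
    by (auto simp: restrict_coords_def fun_eq_iff)
  moreover have "nE (restrict_coords (- {i. y i \<noteq> 0}) (b - y)) \<le> nE (b - y)"
    by (intro restrict_E diff_E b finite_support_E fin)
  ultimately show thesis
    using that[OF fin] y(2) by simp
qed

lemma convexity_modulus_bound:
  assumes a: "a \<in> E" "nE a \<le> 1" and b: "b \<in> E" "nE b \<le> 1" and "\<epsilon> \<le> nE (a - b)"
  shows "nE (a + b) \<le> 2 - 2 * convexity_modulus E nE \<epsilon>"
proof -
  have half: "nE ((1/2) *\<^sub>R (x + y)) = nE (x + y) / 2" if "x \<in> E" "y \<in> E" for x y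
    using scale_E[OF add_E[OF that], of "1/2"] by simp
  have "convexity_modulus E nE \<epsilon> \<le> 1 - nE ((1/2) *\<^sub>R (a + b))"
    unfolding convexity_modulus_def
  proof (rule cInf_lower)
    show "bdd_below {1 - nE ((1/2) *\<^sub>R (x + y)) | x y.
        x \<in> unit_ball E nE \<and> y \<in> unit_ball E nE \<and> nE (x - y) \<ge> \<epsilon>}"
    proof (rule bdd_belowI[of _ 0], clarify)
      fix x y assume "x \<in> unit_ball E nE" "y \<in> unit_ball E nE"
      then show "0 \<le> 1 - nE ((1/2) *\<^sub>R (x + y))"
        using triangle_E[of x y] half[of x y] by (auto simp: unit_ball_def)
    qed
  qed (use assms in \<open>auto simp: unit_ball_def\<close>)
  with half[OF a(1) b(1)] show ?thesis by simp
qed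

end

section \<open>Absolute sums and their restrictions\<close>

lemma liminf_le_garcia_falset:
  assumes "y \<in> unit_ball V N" "\<And>n. x n \<in> unit_ball V N" "weakly_null_on V N x"
  shows "liminf (\<lambda>n. ereal (N (x n + y))) \<le> garcia_falset V N"
  unfolding garcia_falset_def
  by (rule Sup_upper, rule CollectI, rule exI[of _ x], rule exI[of _ y]) (use assms in simp)

lemma normed_on_restrict_family:
  assumes "normed_on (X i) (nX i)"
  shows "normed_on (restrict_family J X i) (nX i)"
proof -
  have "0 \<in> X i"
    using assms by (simp add: normed_on_def subspace_0)
  then show ?thesis
    using assms by (auto simp: normed_on_def restrict_family_def subspace_def)
qed

locale absolute_sum = absolute_space E nE
  for E :: "('i \<Rightarrow> real) set" and nE +
  fixes X :: "'i \<Rightarrow> 'b::real_vector set" and nX :: "'i \<Rightarrow> 'b \<Rightarrow> real"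
  assumes normed_X: "normed_on (X i) (nX i)"
begin

abbreviation "Z \<equiv> abs_sum E X nX"
abbreviation "nZ \<equiv> abs_sum_norm nE nX"

lemma subspace_X: "subspace (X i)"
  and nonneg_X: "x \<in> X i \<Longrightarrow> 0 \<le> nX i x"
  and eq_0_X: "x \<in> X i \<Longrightarrow> nX i x = 0 \<longleftrightarrow> x = 0"
  and scale_X: "x \<in> X i \<Longrightarrow> nX i (c *\<^sub>R x) = \<bar>c\<bar> * nX i x"
  and triangle_X: "x \<in> X i \<Longrightarrow> y \<in> X i \<Longrightarrow> nX i (x + y) \<le> nX i x + nX i y"
  using normed_X[of i] by (auto simp: normed_on_def)

lemma norm_0_X: "nX i 0 = 0"
  using eq_0_X[OF subspace_0[OF subspace_X]] by simp

lemma add_Z: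
  assumes "x \<in> Z" "y \<in> Z"
  shows "x + y \<in> Z" "nZ (x + y) \<le> nE ((\<lambda>i. nX i (x i)) + (\<lambda>i. nX i (y i)))"
proof -
  have xy: "x i \<in> X i" "y i \<in> X i" for i
    using assms by (auto simp: abs_sum_def)
  have E: "(\<lambda>i. nX i (x i)) \<in> E" "(\<lambda>i. nX i (y i)) \<in> E"
    using assms by (auto simp: abs_sum_def)
  have X: "(x + y) i \<in> X i" for i
    using xy by (simp add: subspace_add[OF subspace_X])
  have le: "\<bar>nX i ((x + y) i)\<bar> \<le> \<bar>((\<lambda>i. nX i (x i)) + (\<lambda>i. nX i (y i))) i\<bar>" for i
    using triangle_X[OF xy, of i] nonneg_X[OF X, of i] by simp
  note * = mono_E[where a = "\<lambda>i. nX i ((x + y) i)", OF add_E[OF E] le]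
  show "x + y \<in> Z"
    using X *(1) by (simp add: abs_sum_def)
  show "nZ (x + y) \<le> nE ((\<lambda>i. nX i (x i)) + (\<lambda>i. nX i (y i)))"
    unfolding abs_sum_norm_def by (rule *(2))
qed

lemma triangle_Z: "x \<in> Z \<Longrightarrow> y \<in> Z \<Longrightarrow> nZ (x + y) \<le> nZ x + nZ y"
  using add_Z(2)[of x y] triangle_E[of "\<lambda>i. nX i (x i)" "\<lambda>i. nX i (y i)"]
  by (simp add: abs_sum_def abs_sum_norm_def)

lemma zero_Z: "0 \<in> Z" "nZ 0 = 0"
  using zero_E eq_0_E[OF zero_E] subspace_0[OF subspace_X]
  by (auto simp: abs_sum_def abs_sum_norm_def norm_0_X zero_fun_def)

lemma norms_restrict_coords:
  "(\<lambda>i. nX i (restrict_coords S x i)) = restrict_coords S (\<lambda>i. nX i (x i))"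
  by (auto simp: restrict_coords_def norm_0_X fun_eq_iff)

lemma restrict_Z:
  assumes "x \<in> Z"
  shows "restrict_coords S x \<in> Z" "nZ (restrict_coords S x) \<le> nZ x"
    "restrict_coords S x \<in> abs_sum E (restrict_family S X) nX"
proof -
  have E: "(\<lambda>i. nX i (x i)) \<in> E" and "x i \<in> X i" for i
    using assms by (auto simp: abs_sum_def)
  then have X: "restrict_coords S x i \<in> X i"
    "restrict_coords S x i \<in> restrict_family S X i" for i
    using subspace_0[OF subspace_X] by (auto simp: restrict_coords_def restrict_family_def)
  show "restrict_coords S x \<in> Z" "restrict_coords S x \<in> abs_sum E (restrict_family S X) nX"
    using X restrict_E(1)[OF E] by (auto simp: abs_sum_def norms_restrict_coords)
  show "nZ (restrict_coords S x) \<le> nZ x"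
    using restrict_E(2)[OF E] by (simp add: abs_sum_norm_def norms_restrict_coords)
qed

text \<open>
  Restriction to \<open>J\<close> is a contraction of the full sum onto the sum over \<open>J\<close>, so every bounded
  functional on the latter pulls back to one on the former.
\<close>

lemma weakly_null_restrict:
  assumes "weakly_null_on Z nZ x"
  shows "weakly_null_on (abs_sum E (restrict_family J X) nX) nZ (\<lambda>n. restrict_coords J (x n))"
  unfolding weakly_null_on_def
proof (intro conjI allI impI)
  show "restrict_coords J (x n) \<in> abs_sum E (restrict_family J X) nX" for n
    using assms by (auto simp: weakly_null_on_def intro: restrict_Z)
next
  fix \<phi> assume "bounded_functional_on (abs_sum E (restrict_family J X) nX) nZ \<phi>"
  then obtain C
    where add: "\<And>x y. x \<in> abs_sum E (restrict_family J X) nX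
        \<Longrightarrow> y \<in> abs_sum E (restrict_family J X) nX \<Longrightarrow> \<phi> (x + y) = \<phi> x + \<phi> y"
      and scale: "\<And>c x. x \<in> abs_sum E (restrict_family J X) nX \<Longrightarrow> \<phi> (c *\<^sub>R x) = c * \<phi> x"
      and bound: "\<And>x. x \<in> abs_sum E (restrict_family J X) nX \<Longrightarrow> \<bar>\<phi> x\<bar> \<le> C * nZ x"
    unfolding bounded_functional_on_def by blast
  have "restrict_coords J (x + y) = restrict_coords J x + restrict_coords J y" for x y :: "'i \<Rightarrow> 'b"
    by (auto simp: restrict_coords_def fun_eq_iff)
  moreover have "restrict_coords J (c *\<^sub>R x) = c *\<^sub>R restrict_coords J x" for c and x :: "'i \<Rightarrow> 'b"
    by (auto simp: restrict_coords_def scaleR_fun_def fun_eq_iff)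
  moreover have "\<bar>\<phi> (restrict_coords J x)\<bar> \<le> \<bar>C\<bar> * nZ x" if "x \<in> Z" for x
  proof -
    have "0 \<le> nZ (restrict_coords J x)"
      using restrict_Z(1)[OF that] nonneg_E by (simp add: abs_sum_def abs_sum_norm_def)
    then have "C * nZ (restrict_coords J x) \<le> \<bar>C\<bar> * nZ x"
      using restrict_Z(2)[OF that] by (intro mult_mono) auto
    with bound[OF restrict_Z(3)[OF that]] show ?thesis by linarith
  qed
  ultimately have "bounded_functional_on Z nZ (\<lambda>x. \<phi> (restrict_coords J x))"
    unfolding bounded_functional_on_def
    by (intro conjI exI[of _ "\<bar>C\<bar>"] ballI allI) (simp_all add: add scale restrict_Z(3))
  with assms show "(\<lambda>n. \<phi> (restrict_coords J (x n))) \<longlonglongrightarrow> 0"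
    unfolding weakly_null_on_def by blast
qed

lemma garcia_falset_nonneg: "0 \<le> garcia_falset Z nZ"
proof -
  have "(\<lambda>n. \<phi> 0) \<longlonglongrightarrow> 0" if "bounded_functional_on Z nZ \<phi>" for \<phi> :: "('i \<Rightarrow> 'b) \<Rightarrow> real"
  proof -
    have "\<phi> (0 *\<^sub>R 0) = 0 * \<phi> 0"
      using that zero_Z(1) unfolding bounded_functional_on_def by blast
    then have "\<phi> 0 = 0"
      by (simp only: scaleR_zero_left mult_zero_left)
    then show ?thesis
      by (simp only: tendsto_const)
  qed
  then have "weakly_null_on Z nZ (\<lambda>n. 0)"
    using zero_Z(1) unfolding weakly_null_on_def by blast
  moreover have "0 \<in> unit_ball Z nZ"
    using zero_Z by (simp add: unit_ball_def)
  ultimately have "liminf (\<lambda>n. ereal (nZ (0 + 0))) \<le> garcia_falset Z nZ"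
    using liminf_le_garcia_falset[of 0 Z nZ "\<lambda>n. 0"] by blast
  then show ?thesis
    by (simp only: add_0_right zero_Z(2) Liminf_const[OF sequentially_bot] zero_ereal_def)
qed

section \<open>The coefficient of an absolute sum\<close>

text \<open>
  The dichotomy for a single pair \<open>x, y\<close>: the functions \<open>a\<close> and \<open>b\<close> of coordinate norms are either
  far apart in \<open>E\<close>, which makes \<open>\<parallel>a + b\<parallel>\<close> small by convexity, or close, which makes the tail of
  \<open>x\<close> as small as that of \<open>y\<close> up to \<open>\<epsilon>\<close>.
\<close>

lemma norm_add_le_of_restriction:
  assumes x: "x \<in> unit_ball Z nZ" and y: "y \<in> unit_ball Z nZ"
    and tail: "nZ (restrict_coords (- J) y) \<le> \<eta>"
    and head: "nZ (restrict_coords J x + restrict_coords J y) \<le> r"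
  shows "nZ (x + y) \<le> max (2 - 2 * convexity_modulus E nE \<epsilon>) (r + \<epsilon> + 2 * \<eta>)"
proof -
  define a where "a = (\<lambda>i. nX i (x i))"
  define b where "b = (\<lambda>i. nX i (y i))"
  have Z: "x \<in> Z" "y \<in> Z" and ab: "a \<in> E" "nE a \<le> 1" "b \<in> E" "nE b \<le> 1"
    using x y by (auto simp: unit_ball_def a_def b_def abs_sum_def abs_sum_norm_def)
  show ?thesis
  proof (cases "\<epsilon> \<le> nE (a - b)")
    case True
    have "nZ (x + y) \<le> nE (a + b)"
      using add_Z(2)[OF Z] by (simp add: a_def b_def)
    also have "\<dots> \<le> 2 - 2 * convexity_modulus E nE \<epsilon>"
      by (rule convexity_modulus_bound[OF ab True])
    finally show ?thesis by simp
  next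
    case False
    have norm_tail: "nZ (restrict_coords (- J) x) = nE (restrict_coords (- J) a)"
      "nZ (restrict_coords (- J) y) = nE (restrict_coords (- J) b)"
      by (simp_all add: abs_sum_norm_def norms_restrict_coords a_def b_def)
    have "restrict_coords (- J) a = restrict_coords (- J) (a - b) + restrict_coords (- J) b"
      by (auto simp: restrict_coords_def fun_eq_iff)
    then have "nE (restrict_coords (- J) a)
        \<le> nE (restrict_coords (- J) (a - b)) + nE (restrict_coords (- J) b)"
      using triangle_E[OF restrict_E(1)[OF diff_E] restrict_E(1)] ab by metis
    also have "\<dots> \<le> \<epsilon> + \<eta>"
      using False restrict_E(2)[OF diff_E[OF ab(1,3)], of "- J"] tail norm_tail by simp
    finally have tail_x: "nZ (restrict_coords (- J) x) \<le> \<epsilon> + \<eta>"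
      by (simp add: norm_tail)
    note ZJ = restrict_Z(1)[OF Z(1)] restrict_Z(1)[OF Z(2)]
    have "x + y = (restrict_coords J x + restrict_coords J y)
        + (restrict_coords (- J) x + restrict_coords (- J) y)"
      by (auto simp: restrict_coords_def fun_eq_iff)
    then have "nZ (x + y) \<le> nZ (restrict_coords J x + restrict_coords J y)
        + nZ (restrict_coords (- J) x + restrict_coords (- J) y)"
      using triangle_Z[OF add_Z(1)[OF ZJ] add_Z(1)[OF ZJ]] by metis
    also have "\<dots> \<le> r + (nZ (restrict_coords (- J) x) + nZ (restrict_coords (- J) y))"
      by (intro add_mono head triangle_Z ZJ)
    also have "\<dots> \<le> r + \<epsilon> + 2 * \<eta>"
      using tail tail_x by simp
    finally show ?thesis by simp
  qed
qed

lemma garcia_falset_abs_sum_le: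
  assumes dense: "dense_in (span (range unit_fun)) E nE"
    and fin: "\<And>J. finite J \<Longrightarrow> garcia_falset (abs_sum E (restrict_family J X) nX) nZ \<le> ereal \<alpha>"
  shows "garcia_falset Z nZ \<le> ereal (max (2 - 2 * convexity_modulus E nE \<epsilon>) (\<alpha> + \<epsilon>))"
  unfolding garcia_falset_def
proof (rule Sup_least, clarify)
  fix x y
  assume y: "y \<in> unit_ball Z nZ" and x: "\<forall>n. x n \<in> unit_ball Z nZ" and null: "weakly_null_on Z nZ x"
  have y_E: "(\<lambda>i. nX i (y i)) \<in> E"
    using y by (simp add: unit_ball_def abs_sum_def)
  let ?m = "max (2 - 2 * convexity_modulus E nE \<epsilon>) (\<alpha> + \<epsilon>)"
  show "liminf (\<lambda>n. ereal (nZ (x n + y))) \<le> ereal ?m"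
  proof (rule ereal_le_epsilon2)
    fix e :: real assume "0 < e"
    define \<eta> where "\<eta> = e / 3"
    have "0 < \<eta>" using \<open>0 < e\<close> by (simp add: \<eta>_def)
    obtain J where J: "finite J" and small: "nE (restrict_coords (- J) (\<lambda>i. nX i (y i))) < \<eta>"
      using finite_set_small_tail[OF dense y_E \<open>0 < \<eta>\<close>] .
    let ?Y = "abs_sum E (restrict_family J X) nX"
    have tail: "nZ (restrict_coords (- J) y) \<le> \<eta>"
      using small by (simp add: abs_sum_norm_def norms_restrict_coords)
    have ball: "restrict_coords J z \<in> unit_ball ?Y nZ" if "z \<in> unit_ball Z nZ" for z
      using that restrict_Z(2,3)[of z J] by (auto simp: unit_ball_def)
    have "liminf (\<lambda>n. ereal (nZ (restrict_coords J (x n) + restrict_coords J y)))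
        \<le> garcia_falset ?Y nZ"
      by (rule liminf_le_garcia_falset[OF ball[OF y] ball[OF x[rule_format]]
            weakly_null_restrict[OF null]])
    also have "\<dots> \<le> ereal \<alpha>"
      using fin[OF J] .
    also have "\<dots> < ereal (\<alpha> + \<eta>)"
      using \<open>0 < \<eta>\<close> by simp
    finally have "\<exists>\<^sub>F n in sequentially.
        nZ (restrict_coords J (x n) + restrict_coords J y) < \<alpha> + \<eta>"
      using Liminf_bounded[of "ereal (\<alpha> + \<eta>)"
          "\<lambda>n. ereal (nZ (restrict_coords J (x n) + restrict_coords J y))" sequentially]
      unfolding frequently_def by (auto simp: not_less)
    then have often: "\<exists>\<^sub>F n in sequentially. nZ (x n + y) \<le> ?m + e"
    proof (rule frequently_elim1)
      fix n assume "nZ (restrict_coords J (x n) + restrict_coords J y) < \<alpha> + \<eta>"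
      then have "nZ (x n + y)
          \<le> max (2 - 2 * convexity_modulus E nE \<epsilon>) (\<alpha> + \<eta> + \<epsilon> + 2 * \<eta>)"
        by (intro norm_add_le_of_restriction[OF x[rule_format] y tail] less_imp_le)
      also have "\<dots> \<le> ?m + e"
        using \<open>0 < e\<close> by (auto simp: \<eta>_def)
      finally show "nZ (x n + y) \<le> ?m + e" .
    qed
    show "liminf (\<lambda>n. ereal (nZ (x n + y))) \<le> ereal ?m + ereal e"
    proof (rule ccontr)
      assume "\<not> ?thesis"
      then have "ereal (?m + e) < liminf (\<lambda>n. ereal (nZ (x n + y)))"
        by (simp only: not_le plus_ereal.simps)
      then have "\<forall>\<^sub>F n in sequentially. ereal (?m + e) < ereal (nZ (x n + y))"
        by (rule less_LiminfD)
      with often show False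
        by (simp add: frequently_def not_le)
    qed
  qed
qed

end

theorem theorem3p2:
  fixes E :: "('i \<Rightarrow> real) set" and nE :: "('i \<Rightarrow> real) \<Rightarrow> real"
    and X :: "'i \<Rightarrow> 'b::real_vector set" and nX :: "'i \<Rightarrow> 'b \<Rightarrow> real"
    and \<alpha> :: real
  assumes "infinite (UNIV :: 'i set)"
    and "absolute_normalised E nE"
    and "dense_in (span (range unit_fun)) E nE"
    and "\<And>i. banach_on (X i) (nX i)"
    and "ereal \<alpha> = (SUP J \<in> {J. finite J}.
           garcia_falset (abs_sum E (restrict_family J X) nX) (abs_sum_norm nE nX))"
    and "\<alpha> < 2"
    and "convexity_modulus E nE ((1 - \<alpha> / 2)\<^sup>2) > 0"
  shows "garcia_falset (abs_sum E X nX) (abs_sum_norm nE nX) < 2"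
proof -
  have normed: "normed_on (X i) (nX i)" for i
    using assms(4) by (simp add: banach_on_def)
  interpret absolute_sum E nE X nX
    by unfold_locales (fact assms(2), rule normed)
  interpret empty: absolute_sum E nE "restrict_family {} X" nX
    by unfold_locales (intro normed_on_restrict_family normed)
  have fin: "garcia_falset (abs_sum E (restrict_family J X) nX) nZ \<le> ereal \<alpha>" if "finite J" for J
    unfolding assms(5) by (rule SUP_upper) (simp add: that)
  \<comment> \<open>Without \<open>0 \<le> \<alpha>\<close> the bound \<open>1 + (\<alpha>/2)\<^sup>2\<close> need not be below \<open>2\<close>.\<close>
  have "0 \<le> \<alpha>"
    using order_trans[OF empty.garcia_falset_nonneg fin[of "{}"]] by simp
  then have "\<alpha> * \<alpha> < 2 * 2"
    using assms(6) by (intro mult_strict_mono) auto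
  then have "\<alpha> + (1 - \<alpha> / 2)\<^sup>2 < 2"
    by (simp add: power2_eq_square field_simps)
  with assms(7) have
    "max (2 - 2 * convexity_modulus E nE ((1 - \<alpha> / 2)\<^sup>2)) (\<alpha> + (1 - \<alpha> / 2)\<^sup>2) < 2"
    by simp
  then have "ereal (max (2 - 2 * convexity_modulus E nE ((1 - \<alpha> / 2)\<^sup>2)) (\<alpha> + (1 - \<alpha> / 2)\<^sup>2)) < 2"
    by (simp only: numeral_eq_ereal less_ereal.simps)
  with garcia_falset_abs_sum_le[OF assms(3) fin] show ?thesis
    by (rule le_less_trans)
qed

end
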